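(* Let $E$ be a Dedekind complete vector lattice, let $T$ be a positive operator on $E$, and let $\varphi$ be a positive linear functional on $E$ with $T'\varphi \le \varphi$. Put $S_n := \sum_{k=0}^{n-1} T^k$ for $n \in \mathbb{N}$ and $$M_N \colon E \to E, \qquad M_N x := \max_{1 \le n \le N} S_n x, \qquad N \in \mathbb{N}.$$ Let $x \in E$, $N \in \mathbb{N}$, and let $P_N$ be the band projection onto the band $\{(M_N x)^+\}^{\perp\perp}$ generated by $(M_N x)^+$. Then $$\varphi(P_N x) \ge 0.$$
   Context: A positive operator is a linear map $T \colon E \to E$ with $T(E_+) \subseteq E_+$. Here $T'\varphi := \varphi \circ T$, so $T'\varphi \le \varphi$ means $\varphi(Tz) \le \varphi(z)$ for all $z \in E_+$. The maximum of finitely many elements is their lattice supremum. In a Dedekind complete vector lattice every band $B$ satisfies $E = B \oplus B^\perp$, and the band projection onto $B$ is the projection onto $B$ with kernel $B^\perp$. *)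

theory Defs
  imports Complex_Main "HOL-Library.Lattice_Algebras"
begin

text \<open>
  A Dedekind complete vector lattice is rendered as a type class. The class
  \<^class>\<open>conditionally_complete_lattice\<close> supplies Dedekind completeness (nonempty order bounded
  sets have a supremum and an infimum), while \<^class>\<open>lattice_ab_group_add_abs\<close> supplies
  \<open>\<bar>a\<bar> = sup a (- a)\<close> and the positive part \<open>pprt a = sup a 0\<close>.
\<close>

class dedekind_complete_vector_lattice =
  ordered_real_vector + lattice_ab_group_add_abs + conditionally_complete_lattice

text \<open>
  Used both for operators on \<open>E\<close> and for functionals (codomain \<open>real\<close>).
\<close>

definition positive_linear ::
    "('a::ordered_real_vector \<Rightarrow> 'b::ordered_real_vector) \<Rightarrow> bool" where
  "positive_linear f \<longleftrightarrow> linear f \<and> (\<forall>z\<ge>0. 0 \<le> f z)"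

definition disjoint_complement ::
    "'a::dedekind_complete_vector_lattice set \<Rightarrow> 'a set" where
  "disjoint_complement A = {y. \<forall>a\<in>A. inf \<bar>a\<bar> \<bar>y\<bar> = 0}"

text \<open>
  The linear projection onto \<open>B\<close> with kernel the disjoint complement of \<open>B\<close>; it is meaningful
  only when \<open>B\<close> is a band, where Dedekind completeness gives existence and uniqueness.
\<close>

definition band_projection ::
    "'a::dedekind_complete_vector_lattice set \<Rightarrow> 'a \<Rightarrow> 'a" where
  "band_projection B =
     (THE P. linear P \<and> (\<forall>y. P (P y) = P y) \<and> range P = B \<and>
             {y. P y = 0} = disjoint_complement B)"

definition ergodic_sum :: "('a \<Rightarrow> 'a) \<Rightarrow> nat \<Rightarrow> 'a \<Rightarrow> 'a::comm_monoid_add" where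
  "ergodic_sum T n x = (\<Sum>k<n. (T ^^ k) x)"

text \<open>
  \<^const>\<open>Sup_fin\<close> is the lattice supremum of a nonempty finite set, so the definition is meaningful
  only for \<open>N \<ge> 1\<close>.
\<close>

definition maximal_sum ::
    "('a \<Rightarrow> 'a) \<Rightarrow> nat \<Rightarrow> 'a \<Rightarrow> 'a::dedekind_complete_vector_lattice" where
  "maximal_sum T N x = Sup_fin ((\<lambda>n. ergodic_sum T n x) ` {1..N})"

end

theory Submission
  imports Defs
begin

text \<open>
  Put \<open>M = M\<^sub>N x\<close> and \<open>u = M\<^sup>+\<close>. Since \<open>S\<^sub>1 x = x\<close> and \<open>S\<^sub>n\<^sub>+\<^sub>1 x = x + T (S\<^sub>n x)\<close>,
  positivity of \<open>T\<close> gives \<open>M \<le> x + T u\<close>. The band projection \<open>P\<close> onto the band generated by \<open>u\<close>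
  satisfies \<open>P M = u\<close> (the negative part of \<open>M\<close> is disjoint from \<open>u\<close>) and \<open>0 \<le> P z \<le> z\<close> for
  \<open>z \<ge> 0\<close>, so \<open>P x \<ge> P M - P (T u) \<ge> u - T u\<close>, and \<open>\<phi>\<close> of the right-hand side is nonnegative.
\<close>

section \<open>Inequalities for positive maps, infima and absolute values\<close>

lemma positive_linear_mono:
  assumes "positive_linear f" "x \<le> y"
  shows "f x \<le> f y"
proof -
  have "0 \<le> f (y - x)"
    using assms by (simp add: positive_linear_def)
  then show ?thesis
    using assms(1) by (simp add: positive_linear_def linear_diff)
qed

text \<open>Since addition distributes over \<open>inf\<close>, the right-hand side is the infimum
  of \<open>a + a\<close>, \<open>a + c\<close>, \<open>b + a\<close> and \<open>b + c\<close>; the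
  left-hand side lies below each of these.\<close>

lemma inf_add_le:
  fixes a b c :: "'a::lattice_ab_group_add"
  assumes "0 \<le> a" "0 \<le> b" "0 \<le> c"
  shows "inf a (b + c) \<le> inf a b + inf a c"
proof -
  have "inf a (b + c) \<le> a + a" "inf a (b + c) \<le> a + c" "inf a (b + c) \<le> b + a"
    using assms by (auto intro: le_infI1 add_increasing add_increasing2)
  then show ?thesis
    by (simp add: add_inf_distrib_left add_inf_distrib_right le_infI2)
qed

text \<open>The infimum lies below one common multiple of \<open>a\<close> and \<open>b\<close>;
  dividing by that factor brings it below \<open>inf a b\<close>.\<close>

lemma inf_scaleR_eq_0:
  fixes a b :: "'a::dedekind_complete_vector_lattice"
  assumes "0 \<le> a" "0 \<le> b" "inf a b = 0" "0 \<le> r"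
  shows "inf a (r *\<^sub>R b) = 0"
proof (rule antisym)
  \<comment> \<open>\<open>s\<close> is at least 1 so that \<open>a\<close> \<le>
    \<open>s *\<^sub>R a\<close>, at least \<open>r\<close> so that \<open>s *\<^sub>R b\<close>
    dominates \<open>r *\<^sub>R b\<close>, and positive so that it can be inverted.\<close>
  define s where "s = max r 1"
  define w where "w = inf a (r *\<^sub>R b)"
  have s: "1 \<le> s" "r \<le> s" by (auto simp: s_def)
  show "0 \<le> inf a (r *\<^sub>R b)"
    using assms by (simp add: scaleR_nonneg_nonneg)
  have "w \<le> s *\<^sub>R a"
    using scaleR_right_mono[OF s(1) assms(1)] by (simp add: w_def le_infI1)
  moreover have "w \<le> s *\<^sub>R b"
    using scaleR_right_mono[OF s(2) assms(2)] by (simp add: w_def le_infI2)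
  ultimately have "inverse s *\<^sub>R w \<le> inf a b"
    using s scaleR_left_mono[of w "s *\<^sub>R a" "inverse s"]
      scaleR_left_mono[of w "s *\<^sub>R b" "inverse s"] by simp
  then have "s *\<^sub>R (inverse s *\<^sub>R w) \<le> s *\<^sub>R 0"
    using assms(3) s by (intro scaleR_left_mono) auto
  then show "inf a (r *\<^sub>R b) \<le> 0"
    using s by (simp add: w_def)
qed

lemma abs_scaleR_le:
  fixes a :: "'a::dedekind_complete_vector_lattice"
  shows "\<bar>r *\<^sub>R a\<bar> \<le> \<bar>r\<bar> *\<^sub>R \<bar>a\<bar>"
proof -
  have pos: "s *\<^sub>R a \<le> s *\<^sub>R \<bar>a\<bar>" "- (s *\<^sub>R a) \<le> s *\<^sub>R \<bar>a\<bar>" if "0 \<le> s" for s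
    using scaleR_left_mono[OF abs_ge_self that, of a]
      scaleR_left_mono[OF abs_ge_minus_self that, of a] by simp_all
  show ?thesis
    using pos[of r] pos[of "- r"] by (cases "0 \<le> r") (auto intro: abs_leI)
qed

section \<open>Disjoint complements as solid subspaces\<close>

lemma disjoint_complement_solid:
  assumes "y \<in> disjoint_complement A" "\<bar>z\<bar> \<le> \<bar>y\<bar>"
  shows "z \<in> disjoint_complement A"
proof -
  have "inf \<bar>a\<bar> \<bar>z\<bar> = 0" if "a \<in> A" for a
  proof (rule antisym)
    have "inf \<bar>a\<bar> \<bar>z\<bar> \<le> inf \<bar>a\<bar> \<bar>y\<bar>"
      using assms(2) by (intro inf_mono) auto
    also have "\<dots> = 0"
      using assms(1) that by (simp add: disjoint_complement_def)
    finally show "inf \<bar>a\<bar> \<bar>z\<bar> \<le> 0" .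
  qed simp
  then show ?thesis by (simp add: disjoint_complement_def)
qed

text \<open>Sums are handled by the triangle inequality and \<open>inf_add_le\<close>, scalar
  multiples by \<open>abs_scaleR_le\<close> and \<open>inf_scaleR_eq_0\<close>. Linearity of band
  projections rests on this.\<close>

lemma subspace_disjoint_complement: "subspace (disjoint_complement A)"
proof (rule subspaceI)
  show "0 \<in> disjoint_complement A"
    by (simp add: disjoint_complement_def inf_absorb2)
next
  fix y z assume y: "y \<in> disjoint_complement A" and z: "z \<in> disjoint_complement A"
  have "inf \<bar>a\<bar> \<bar>y + z\<bar> = 0" if a: "a \<in> A" for a
  proof (rule antisym)
    have "inf \<bar>a\<bar> \<bar>y + z\<bar> \<le> inf \<bar>a\<bar> (\<bar>y\<bar> + \<bar>z\<bar>)"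
      by (intro inf_mono abs_triangle_ineq order_refl)
    also have "\<dots> \<le> inf \<bar>a\<bar> \<bar>y\<bar> + inf \<bar>a\<bar> \<bar>z\<bar>"
      by (rule inf_add_le) auto
    also have "\<dots> = 0"
      using y z a by (simp add: disjoint_complement_def)
    finally show "inf \<bar>a\<bar> \<bar>y + z\<bar> \<le> 0" .
  qed simp
  then show "y + z \<in> disjoint_complement A"
    by (simp add: disjoint_complement_def)
next
  fix r y assume y: "y \<in> disjoint_complement A"
  have "inf \<bar>a\<bar> \<bar>r *\<^sub>R y\<bar> = 0" if a: "a \<in> A" for a
  proof (rule antisym)
    have "inf \<bar>a\<bar> \<bar>r *\<^sub>R y\<bar> \<le> inf \<bar>a\<bar> (\<bar>r\<bar> *\<^sub>R \<bar>y\<bar>)"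
      by (intro inf_mono abs_scaleR_le order_refl)
    also have "\<dots> = 0"
      using y a by (intro inf_scaleR_eq_0) (auto simp: disjoint_complement_def)
    finally show "inf \<bar>a\<bar> \<bar>r *\<^sub>R y\<bar> \<le> 0" .
  qed simp
  then show "r *\<^sub>R y \<in> disjoint_complement A"
    by (simp add: disjoint_complement_def)
qed

section \<open>Decomposition of the space along a band\<close>

lemma disjoint_complement_Int_trivial:
  assumes "y \<in> B" "y \<in> disjoint_complement B"
  shows "y = 0"
  using assms by (auto simp: disjoint_complement_def)

text \<open>The band component of \<open>z\<close> is the largest element of the band between \<open>0\<close> and \<open>z\<close>.\<close>

lemma band_decomposition_nonneg:
  fixes z :: "'a::dedekind_complete_vector_lattice" and A :: "'a set"
  defines "B \<equiv> disjoint_complement A"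
  assumes z: "0 \<le> z"
  obtains b where "b \<in> B" "z - b \<in> disjoint_complement B" "0 \<le> b" "b \<le> z"
proof -
  define S where "S = {b \<in> B. 0 \<le> b \<and> b \<le> z}"
  define p where "p = Sup S"
  have sub: "subspace B" unfolding B_def by (rule subspace_disjoint_complement)
  have S0: "0 \<in> S" using sub z by (simp add: S_def subspace_0)
  have bdd: "bdd_above S" by (rule bdd_aboveI[of _ z]) (simp add: S_def)
  have upper: "b \<le> p" if "b \<in> S" for b
    unfolding p_def using that bdd by (rule cSup_upper)
  have least: "p \<le> c" if "\<And>b. b \<in> S \<Longrightarrow> b \<le> c" for c
    unfolding p_def using S0 that by (intro cSup_least) auto
  have p0: "0 \<le> p" using upper S0 .
  have pz: "p \<le> z" by (rule least) (simp add: S_def)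
  have "p \<in> B"
    unfolding B_def disjoint_complement_def
  proof (intro CollectI ballI)
    fix a assume a: "a \<in> A"
    define w where "w = inf \<bar>a\<bar> p"
    have w0: "0 \<le> w" using p0 by (simp add: w_def)
    \<comment> \<open>If \<open>p - w\<close> still bounds \<open>S\<close> from above, then
      leastness of \<open>p\<close> forces \<open>w = 0\<close>.\<close>
    have "b \<le> p - w" if b: "b \<in> S" for b
    proof -
      have "b \<in> disjoint_complement A" "0 \<le> b"
        using b by (simp_all add: S_def B_def)
      then have "inf \<bar>a\<bar> \<bar>b\<bar> = 0"
        using a unfolding disjoint_complement_def by blast
      moreover have "inf b w \<le> inf \<bar>a\<bar> \<bar>b\<bar>"
        using b by (auto simp: w_def S_def intro: le_infI1 le_infI2)
      \<comment> \<open>As \<open>w\<close> \<le> \<open>\<bar>a\<bar>\<close>, the elements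
        \<open>b\<close> and \<open>w\<close> have infimum at most 0, and \<open>b + w\<close> is
        the sum of their infimum and supremum.\<close>
      ultimately have "b + w \<le> sup b w"
        using add_eq_inf_sup[of b w] by (simp add: add_le_same_cancel2)
      also have "\<dots> \<le> p" using upper[OF b] by (simp add: w_def)
      finally show ?thesis by (simp add: le_diff_eq)
    qed
    then have "p \<le> p - w" by (rule least)
    then have "w = 0" using w0 by (intro antisym) simp_all
    then show "inf \<bar>a\<bar> \<bar>p\<bar> = 0" using p0 by (simp add: w_def)
  qed
  moreover have "z - p \<in> disjoint_complement B"
    unfolding disjoint_complement_def
  proof (intro CollectI ballI)
    fix a assume a: "a \<in> B"
    define w where "w = inf \<bar>a\<bar> (z - p)"
    have w0: "0 \<le> w" using pz by (simp add: w_def)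
    have wB: "w \<in> B"
      using a w0 unfolding B_def
      by (elim disjoint_complement_solid) (simp add: w_def)
    \<comment> \<open>Here \<open>w\<close> lies in \<open>B\<close> and fits into the gap
      \<open>z - p\<close>, so adding it to \<open>b\<close> does not leave \<open>S\<close>; again
      \<open>p - w\<close> is an upper bound.\<close>
    have "b \<le> p - w" if b: "b \<in> S" for b
    proof -
      have "b + w \<le> p + (z - p)"
        by (intro add_mono upper b) (simp add: w_def)
      then have "b + w \<in> S"
        using b w0 wB sub by (simp add: S_def subspace_add)
      from upper[OF this] show ?thesis by (simp add: le_diff_eq)
    qed
    then have "p \<le> p - w" by (rule least)
    then have "w = 0" using w0 by (intro antisym) simp_all
    then show "inf \<bar>a\<bar> \<bar>z - p\<bar> = 0" using pz by (simp add: w_def)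
  qed
  ultimately show thesis using that p0 pz by blast
qed

text \<open>Existence follows by decomposing \<open>pprt z\<close> and \<open>pprt (- z)\<close> and
  subtracting; uniqueness because \<open>B\<close> meets its disjoint complement only in 0.\<close>

lemma band_decomposition:
  fixes z :: "'a::dedekind_complete_vector_lattice" and A :: "'a set"
  defines "B \<equiv> disjoint_complement A"
  shows "\<exists>!b. b \<in> B \<and> z - b \<in> disjoint_complement B"
proof -
  have sub: "subspace B" "subspace (disjoint_complement B)"
    by (simp_all add: B_def subspace_disjoint_complement)
  obtain b c where b: "b \<in> B" "pprt z - b \<in> disjoint_complement B"
    and c: "c \<in> B" "pprt (- z) - c \<in> disjoint_complement B"
    using band_decomposition_nonneg[of "pprt z" A] band_decomposition_nonneg[of "pprt (- z)" A]
    unfolding B_def by (metis zero_le_pprt)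
  have "z = pprt z - pprt (- z)"
    using prts[of z] by (simp add: pprt_neg)
  then have "z - (b - c) = (pprt z - b) - (pprt (- z) - c)"
    by (simp add: algebra_simps)
  moreover have "b - c \<in> B" "(pprt z - b) - (pprt (- z) - c) \<in> disjoint_complement B"
    using b c sub by (auto intro: subspace_diff)
  ultimately have "b - c \<in> B \<and> z - (b - c) \<in> disjoint_complement B"
    by (simp only: simp_thms)
  moreover have "p = q"
    if "p \<in> B \<and> z - p \<in> disjoint_complement B" "q \<in> B \<and> z - q \<in> disjoint_complement B" for p q
  proof -
    have "p - q \<in> B" using that sub by (simp add: subspace_diff)
    \<comment> \<open>This element is \<open>p - q\<close> once more, now seen in the
      complement.\<close>
    moreover have "(z - q) - (z - p) \<in> disjoint_complement B"
      using that sub by (blast intro: subspace_diff)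
    ultimately have "p - q = 0"
      by (intro disjoint_complement_Int_trivial[of _ B]) auto
    then show ?thesis by simp
  qed
  ultimately show ?thesis by blast
qed

section \<open>Band projections\<close>

text \<open>The map \<open>Q\<close> that picks the component in \<open>B\<close> satisfies the
  description in \<open>band_projection_def\<close> and is the only map that does. Afterwards a
  value of the projection is found by exhibiting a decomposition.\<close>

lemma
  fixes A :: "'a::dedekind_complete_vector_lattice set"
  defines "B \<equiv> disjoint_complement A"
  shows linear_band_projection: "linear (band_projection B)"
    and band_projection_eqI:
      "\<And>b z. b \<in> B \<Longrightarrow> z - b \<in> disjoint_complement B \<Longrightarrow> band_projection B z = b"
proof -
  let ?C = "disjoint_complement B"
  have sub: "subspace B" "subspace ?C"
    by (simp_all add: B_def subspace_disjoint_complement)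
  define Q where "Q z = (THE b. b \<in> B \<and> z - b \<in> ?C)" for z
  have Q: "Q z \<in> B" "z - Q z \<in> ?C" for z
    using theI'[OF band_decomposition[of A z]] by (simp_all add: Q_def B_def)
  have QI: "Q z = b" if "b \<in> B" "z - b \<in> ?C" for z b
    using band_decomposition[of A z] that Q[of z] unfolding B_def by blast
  have "linear Q"
  proof (rule linearI)
    fix y z
    have "(y - Q y) + (z - Q z) \<in> ?C" "Q y + Q z \<in> B"
      using Q sub by (simp_all add: subspace_add)
    then show "Q (y + z) = Q y + Q z"
      by (intro QI) (simp_all add: algebra_simps)
  next
    fix r z
    have "r *\<^sub>R (z - Q z) \<in> ?C" "r *\<^sub>R Q z \<in> B"
      using Q sub by (simp_all add: subspace_scale)
    then show "Q (r *\<^sub>R z) = r *\<^sub>R Q z"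
      by (intro QI) (simp_all add: algebra_simps)
  qed
  have fixB: "Q z = z" if "z \<in> B" for z
    using that sub by (intro QI) (auto simp: subspace_0)
  have kerC: "Q z = 0 \<longleftrightarrow> z \<in> ?C" for z
    using Q(2)[of z] sub by (auto intro!: QI simp: subspace_0)
  have isQ: "linear Q \<and> (\<forall>y. Q (Q y) = Q y) \<and> range Q = B \<and> {y. Q y = 0} = ?C"
    using \<open>linear Q\<close> fixB kerC Q(1) by (auto simp: image_iff) metis
  have "band_projection B = Q"
    unfolding band_projection_def
  proof (rule the_equality, rule isQ)
    fix P :: "'a \<Rightarrow> 'a"
    assume P: "linear P \<and> (\<forall>y. P (P y) = P y) \<and> range P = B \<and> {y. P y = 0} = ?C"
    \<comment> \<open>Any competitor \<open>P\<close> yields the decomposition of \<open>z\<close>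
      into \<open>P z\<close> in its range \<open>B\<close> and \<open>z - P z\<close> in its
      kernel, so it agrees with \<open>Q\<close>.\<close>
    have "Q z = P z" for z
    proof (rule QI)
      show "P z \<in> B" using P by blast
      have "P (z - P z) = 0" using P by (simp add: linear_diff)
      then show "z - P z \<in> ?C" using P by blast
    qed
    then show "P = Q" by auto
  qed
  then show "linear (band_projection B)"
    "\<And>b z. b \<in> B \<Longrightarrow> z - b \<in> ?C \<Longrightarrow> band_projection B z = b"
    using \<open>linear Q\<close> QI by auto
qed

text \<open>For positive \<open>z\<close> the component in the band was constructed between 0 and
  \<open>z\<close>.\<close>

lemma
  fixes z :: "'a::dedekind_complete_vector_lattice"
  assumes "0 \<le> z"
  shows band_projection_nonneg: "0 \<le> band_projection (disjoint_complement A) z"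
    and band_projection_le: "band_projection (disjoint_complement A) z \<le> z"
  using assms by (auto elim!: band_decomposition_nonneg[of z A] simp: band_projection_eqI)

text \<open>The decomposition of \<open>y\<close> along this band is \<open>pprt y + nprt y\<close>,
  because positive and negative parts are disjoint.\<close>

lemma band_projection_pprt:
  fixes y :: "'a::dedekind_complete_vector_lattice"
  shows "band_projection (disjoint_complement (disjoint_complement {pprt y})) y = pprt y"
proof (rule band_projection_eqI)
  let ?C = "disjoint_complement {pprt y}"
  show "pprt y \<in> disjoint_complement ?C"
    by (auto simp: disjoint_complement_def inf_commute)
  have "inf (pprt y) (- nprt y) = 0"
  proof -
    \<comment> \<open>Both entries are written as translates by \<open>- nprt y\<close>, which can
      be pulled out of the infimum and leaves \<open>inf y 0 = nprt y\<close>.\<close>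
    have "inf (pprt y) (- nprt y) = inf (y - nprt y) (0 - nprt y)"
      using prts[of y] by (metis add_diff_cancel_right' diff_0)
    also have "\<dots> = inf y 0 - nprt y"
      by (simp add: diff_conv_add_uminus add_inf_distrib_right del: add_uminus_conv_diff)
    also have "\<dots> = 0" by (simp add: nprt_def)
    finally show ?thesis .
  qed
  moreover have "y - pprt y = nprt y"
    using prts[of y] by (metis add_diff_cancel_left')
  ultimately have "y - pprt y \<in> ?C"
    by (simp add: disjoint_complement_def)
  \<comment> \<open>Every set is contained in its double disjoint complement.\<close>
  then show "y - pprt y \<in> disjoint_complement (disjoint_complement ?C)"
    by (auto simp: disjoint_complement_def inf_commute)
qed

section \<open>Ergodic sums and the maximal inequality\<close>

lemma ergodic_sum_Suc:
  assumes "linear T"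
  shows "ergodic_sum T (Suc n) x = x + T (ergodic_sum T n x)"
  using assms by (simp add: ergodic_sum_def sum.lessThan_Suc_shift linear_sum del: sum.lessThan_Suc)

lemma maximal_sum_le:
  fixes T :: "'a::dedekind_complete_vector_lattice \<Rightarrow> 'a"
  assumes T: "positive_linear T" and N: "1 \<le> N"
  shows "maximal_sum T N x \<le> x + T (pprt (maximal_sum T N x))"
    (is "?M \<le> x + T ?u")
proof -
  have lin: "linear T" using T by (simp add: positive_linear_def)
  have "ergodic_sum T n x \<le> x + T ?u" if n: "n \<in> {1..N}" for n
  proof -
    obtain m where m: "n = Suc m" using n by (cases n) auto
    have "ergodic_sum T m x \<le> ?u"
    \<comment> \<open>The index 0 is outside the range of the maximum; the empty sum is 0, which is
      bounded by the positive part of \<open>?M\<close> but possibly not by \<open>?M\<close>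
      itself.\<close>
    proof (cases "m = 0")
      case True
      then show ?thesis by (simp add: ergodic_sum_def)
    next
      case False
      then have "ergodic_sum T m x \<le> ?M"
        unfolding maximal_sum_def using n m by (intro Sup_fin.coboundedI) auto
      also have "?M \<le> ?u" by (simp add: pprt_def)
      finally show ?thesis .
    qed
    then show ?thesis
      using positive_linear_mono[OF T] by (simp add: m ergodic_sum_Suc[OF lin])
  qed
  then show ?thesis
    unfolding maximal_sum_def using N by (intro Sup_fin.boundedI) auto
qed

theorem lemma4p1:
  fixes T :: "'a::dedekind_complete_vector_lattice \<Rightarrow> 'a"
    and \<phi> :: "'a \<Rightarrow> real"
    and x :: 'a
    and N :: nat
  assumes "positive_linear T"
    and "positive_linear \<phi>"
    and "\<And>z. 0 \<le> z \<Longrightarrow> \<phi> (T z) \<le> \<phi> z"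
    and "1 \<le> N"
  shows "0 \<le> \<phi> (band_projection
                  (disjoint_complement (disjoint_complement {pprt (maximal_sum T N x)})) x)"
proof -
  define M where "M = maximal_sum T N x"
  define u where "u = pprt M"
  define P where "P = band_projection (disjoint_complement (disjoint_complement {u}))"
  have P: "positive_linear P"
    unfolding P_def positive_linear_def
    by (simp add: linear_band_projection band_projection_nonneg)
  have u: "0 \<le> u" by (simp add: u_def)
  have "0 \<le> T u" using assms(1) u by (simp add: positive_linear_def)
  then have PT: "P (T u) \<le> T u"
    unfolding P_def by (rule band_projection_le)
  have PM: "P M = u" by (simp add: P_def u_def band_projection_pprt)
  have "M \<le> x + T u"
    unfolding M_def u_def by (rule maximal_sum_le[OF assms(1,4)])
  then have "u \<le> P (x + T u)"
    using positive_linear_mono[OF P] PM by metis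
  also have "\<dots> = P x + P (T u)"
    using P by (simp add: positive_linear_def linear_add)
  \<comment> \<open>Replacing \<open>P (T u)\<close> by \<open>T u\<close> removes the projection
    from the last term, so that the hypothesis on \<open>\<phi> (T u)\<close> applies.\<close>
  also have "\<dots> \<le> P x + T u" using PT by simp
  finally have "\<phi> u \<le> \<phi> (P x + T u)"
    by (rule positive_linear_mono[OF assms(2)])
  also have "\<dots> = \<phi> (P x) + \<phi> (T u)"
    using assms(2) by (simp add: positive_linear_def linear_add)
  finally show ?thesis
    using assms(3)[OF u] by (simp add: P_def u_def M_def)
qed

end
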